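(* Let $\mathcal{R}$ be an RGF class. Then there exists a positive integer $k$ with $\mathcal{R} \subseteq \mathcal{SB}_H(k)$ if and only if $\mathcal{R}$ avoids a Cayley permutation from each of $\mathcal{H}_{I,I}$ and $\mathcal{H}_{I,D}$; that is, if and only if there exist $\sigma \in \mathcal{H}_{I,I}$ and $\tau \in \mathcal{H}_{I,D}$ such that every RGF in $\mathcal{R}$ avoids both $\sigma$ and $\tau$.
   Context: A Cayley permutation is a finite word $\pi = \pi_1\pi_2\cdots\pi_n$ of positive integers in which every value between $1$ and the maximum value of $\pi$ appears at least once; its size is $n$ and its height is its maximum value. A restricted growth function (RGF) is a Cayley permutation in which, for every value $v$ occurring and every $1 \le u < v$, the first occurrence of $u$ is to the left of the first occurrence of $v$. The standardisation of a word of positive integers is the Cayley permutation obtained by replacing all occurrences of the smallest value by $1$, of the next smallest value by $2$, and so on. A Cayley permutation $\pi$ contains a Cayley permutation $\sigma$ if some (not necessarily contiguous) subsequence of $\pi$ standardises to $\sigma$; otherwise $\pi$ avoids $\sigma$. For a set $\Pi$ of Cayley permutations, $\mathcal{R}(\Pi)$ is the set of all RGFs that avoid every element of $\Pi$; an RGF class is a set of the form $\mathcal{R}(\Pi)$. A set of RGFs avoids $\sigma$ if each of its elements avoids $\sigma$. Horizontal juxtapositions: a Cayley permutation $\pi$ of size $n+m$ is a horizontal juxtaposition of a Cayley permutation $\sigma$ of size $n$ and a Cayley permutation $\tau$ of size $m$ if the first $n$ entries of $\pi$ standardise to $\sigma$ and the last $m$ entries standardise to $\tau$. $\mathcal{H}_{I,I}$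 is the set of Cayley permutations that are horizontal juxtapositions of a strictly increasing sequence and a strictly increasing sequence; $\mathcal{H}_{I,D}$ is the set of those that are horizontal juxtapositions of a strictly increasing sequence (on the left) and a strictly decreasing sequence (on the right). Horizontal evolution: a Cayley permutation $\pi = \pi_1\cdots\pi_n$ is built by inserting its entries from left to right. For $0 \le t \le n$, the configuration after $t$ insertions consists of the standardisation of $\pi_1\cdots\pi_t$ together with slots: (i) one repeating slot $\overline{\diamond}$ at the height of each value $v$ that occurs in $\pi_1\cdots\pi_t$ and also occurs in $\pi_{t+1}\cdots\pi_n$; and (ii) one new slot $\diamond$ in each gap (below the smallest value of $\pi_1\cdots\pi_t$, strictly between two consecutive distinct values of $\pi_1\cdots\pi_t$, or above the largest; for $t=0$ there is a single gap) that contains at least one value occurring in $\pi_{t+1}\cdots\pi_n$. The horizontal evolution of $\pi$ is the sequence of these configurations. $\mathcal{SB}_H(k)$ is the set of all RGFs such that every configuration in their horizontal evolution has at most $k$ slots in total (new and repeating slots are both counted). *)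

theory Defs
  imports Main "HOL-Library.Sublist"
begin

text \<open>Words are lists of natural numbers. The empty word, of size and height 0, counts as a
  Cayley permutation.\<close>

definition height :: "nat list \<Rightarrow> nat" where
  "height w = Max (insert 0 (set w))"

definition cayley :: "nat list \<Rightarrow> bool" where
  "cayley w \<longleftrightarrow> set w = {1..height w}"

definition first_occ :: "nat list \<Rightarrow> nat \<Rightarrow> nat" where
  "first_occ w v = (LEAST i. i < length w \<and> w ! i = v)"

definition rgf :: "nat list \<Rightarrow> bool" where
  "rgf w \<longleftrightarrow> cayley w \<and>
     (\<forall>v\<in>set w. \<forall>u. 1 \<le> u \<and> u < v \<longrightarrow> first_occ w u < first_occ w v)"

text \<open>The smallest value of a word has rank 1, the next smallest value rank 2, and so on.\<close>

definition rank :: "nat list \<Rightarrow> nat \<Rightarrow> nat" where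
  "rank w v = card {u \<in> set w. u \<le> v}"

definition standardise :: "nat list \<Rightarrow> nat list" where
  "standardise w = map (rank w) w"

definition contains :: "nat list \<Rightarrow> nat list \<Rightarrow> bool" where
  "contains \<pi> \<sigma> \<longleftrightarrow> (\<exists>w. subseq w \<pi> \<and> standardise w = \<sigma>)"

definition avoids :: "nat list \<Rightarrow> nat list \<Rightarrow> bool" where
  "avoids \<pi> \<sigma> \<longleftrightarrow> \<not> contains \<pi> \<sigma>"

definition set_avoids :: "nat list set \<Rightarrow> nat list \<Rightarrow> bool" where
  "set_avoids R \<sigma> \<longleftrightarrow> (\<forall>\<pi>\<in>R. avoids \<pi> \<sigma>)"

definition rgfs_avoiding :: "nat list set \<Rightarrow> nat list set" where
  "rgfs_avoiding B = {\<pi>. rgf \<pi> \<and> (\<forall>\<sigma>\<in>B. avoids \<pi> \<sigma>)}"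

definition rgf_class :: "nat list set \<Rightarrow> bool" where
  "rgf_class R \<longleftrightarrow> (\<exists>B. (\<forall>\<sigma>\<in>B. cayley \<sigma>) \<and> R = rgfs_avoiding B)"

definition horizontal_juxtaposition :: "nat list \<Rightarrow> nat list \<Rightarrow> nat list \<Rightarrow> bool" where
  "horizontal_juxtaposition \<pi> \<sigma> \<tau> \<longleftrightarrow>
     cayley \<pi> \<and> cayley \<sigma> \<and> cayley \<tau> \<and>
     length \<pi> = length \<sigma> + length \<tau> \<and>
     standardise (take (length \<sigma>) \<pi>) = \<sigma> \<and>
     standardise (drop (length \<sigma>) \<pi>) = \<tau>"

definition H_II :: "nat list set" where
  "H_II = {\<pi>. \<exists>\<sigma> \<tau>. horizontal_juxtaposition \<pi> \<sigma> \<tau> \<and>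
     sorted_wrt (<) \<sigma> \<and> sorted_wrt (<) \<tau>}"

definition H_ID :: "nat list set" where
  "H_ID = {\<pi>. \<exists>\<sigma> \<tau>. horizontal_juxtaposition \<pi> \<sigma> \<tau> \<and>
     sorted_wrt (<) \<sigma> \<and> sorted_wrt (>) \<tau>}"

text \<open>Positions of slots refer to the standardised prefix: \<open>Repeating i\<close> is the slot at the height
  of its value \<open>i\<close>, and \<open>New g\<close> is the slot in the gap that has exactly \<open>g\<close> of its distinct
  values below it, so \<open>New 0\<close> lies below the smallest value.\<close>

datatype slot = Repeating nat | New nat

datatype configuration = Configuration (word: "nat list") (slots: "slot set")

definition configuration_after :: "nat list \<Rightarrow> nat \<Rightarrow> configuration" where
  "configuration_after \<pi> t = (let p = take t \<pi>; s = drop t \<pi> in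
     Configuration (standardise p)
       ({Repeating (rank p v) | v. v \<in> set p \<and> v \<in> set s} \<union>
        {New (card {u \<in> set p. u < v}) | v. v \<in> set s \<and> v \<notin> set p}))"

definition horizontal_evolution :: "nat list \<Rightarrow> configuration list" where
  "horizontal_evolution \<pi> = map (configuration_after \<pi>) [0..<Suc (length \<pi>)]"

definition SB_H :: "nat \<Rightarrow> nat list set" where
  "SB_H k = {\<pi>. rgf \<pi> \<and> (\<forall>c\<in>set (horizontal_evolution \<pi>). card (slots c) \<le> k)}"

end

theory Submission
  imports Defs "HOL-Library.Ramsey"
begin

text \<open>
  A repeating slot records a value that occurs on both sides of the cut between \<open>\<pi>\<^sub>1\<dots>\<pi>\<^sub>t\<close> and
  \<open>\<pi>\<^bsub>t+1\<^esub>\<dots>\<pi>\<^sub>n\<close>. In an RGF the values of a prefix form an initial segment of the positive integers,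
  so every new value lies in the gap above the largest one and there is at most one new slot
  (\<open>rgf_card_slots_le\<close>). Bounding the slots of an RGF is therefore the same as bounding the number
  of values that occur on both sides of a cut.

  If that number is bounded by \<open>k\<close>, the words \<open>1 2 \<dots> n 1 2 \<dots> n\<close> and \<open>1 2 \<dots> n n \<dots> 2 1\<close> with
  \<open>n = k + 1\<close> cannot be contained, since cutting an occurrence in the middle leaves \<open>n\<close> values
  common to both sides (\<open>contains_append_imp_card_common\<close>).

  Conversely, suppose that \<open>\<sigma> \<in> H_II\<close> and \<open>\<tau> \<in> H_ID\<close> are avoided and that some cut has many common
  values. The first occurrences of these values increase in the prefix, because the word is an RGF.
  In the suffix, choose one occurrence of each; Ramsey's theorem, applied to the pairs that
  occur in their natural order, gives many values whose chosen occurrences increase or many whose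
  chosen occurrences decrease (\<open>monotone_values_in_word\<close>). So the word contains
  \<open>x\<^sub>1 < \<dots> < x\<^sub>n\<close> followed by \<open>x\<^sub>1 < \<dots> < x\<^sub>n\<close> or by \<open>x\<^sub>n > \<dots> > x\<^sub>1\<close>. The former contains every
  element of \<open>H_II\<close> of height \<open>n\<close> and the latter every element of \<open>H_ID\<close> of height \<open>n\<close>
  (\<open>contains_if_doubled\<close>), so Ramsey's theorem supplies the bound on the number of slots.
\<close>

section \<open>Cayley permutations and standardisation\<close>

lemma height_eq: "set w = {1..n} \<Longrightarrow> height w = n"
proof -
  assume "set w = {1..n}"
  then have "insert 0 (set w) = {0..n}" by auto
  then show ?thesis unfolding height_def by (intro Max_eqI) auto
qed

lemma cayley_iff: "cayley w \<longleftrightarrow> (\<exists>n. set w = {1..n})"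
  using height_eq unfolding cayley_def by blast

lemma rank_mono: "u \<le> v \<Longrightarrow> rank w u \<le> rank w v"
  unfolding rank_def by (rule card_mono) auto

lemma inj_on_rank: "inj_on (rank w) (set w)"
proof (rule linorder_inj_onI)
  fix u v assume uv: "u < v" "v \<in> set w"
  then have "{x \<in> set w. x \<le> u} \<subseteq> {x \<in> set w. x \<le> v}"
    "v \<in> {x \<in> set w. x \<le> v}" "v \<notin> {x \<in> set w. x \<le> u}" by auto
  then have "{x \<in> set w. x \<le> u} \<subset> {x \<in> set w. x \<le> v}" by blast
  then have "rank w u < rank w v" unfolding rank_def by (rule psubset_card_mono[rotated]) simp
  then show "rank w u \<noteq> rank w v" by simp
qed auto

lemma standardise_map:
  assumes "strict_mono_on (set w) f"
  shows "standardise (map f w) = standardise w"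
proof -
  have "rank (map f w) (f v) = rank w v" if v: "v \<in> set w" for v
  proof -
    have "{u \<in> set (map f w). u \<le> f v} = f ` {u \<in> set w. u \<le> v}"
      using assms v by (auto simp: strict_mono_on_less_eq)
    moreover have "inj_on f {u \<in> set w. u \<le> v}"
      using strict_mono_on_imp_inj_on[OF assms] by (rule inj_on_subset) auto
    ultimately show ?thesis unfolding rank_def by (simp add: card_image)
  qed
  then show ?thesis by (simp add: standardise_def)
qed

lemma standardise_cayley:
  assumes "cayley w" shows "standardise w = w"
proof -
  obtain n where n: "set w = {1..n}" using assms cayley_iff by blast
  have "rank w v = v" if "v \<in> set w" for v
  proof -
    have "{u \<in> set w. u \<le> v} = {1..v}" using that n by auto
    then show ?thesis by (simp add: rank_def)
  qed
  then show ?thesis by (simp add: standardise_def map_idI)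
qed

lemma sorted_wrt_less_if_standardise:
  assumes "sorted_wrt (<) (standardise w)" shows "sorted_wrt (<) w"
  using assms unfolding standardise_def sorted_wrt_map
  by (rule sorted_wrt_mono_rel[rotated]) (meson not_le rank_mono)

lemma sorted_wrt_greater_if_standardise:
  assumes "sorted_wrt (>) (standardise w)" shows "sorted_wrt (>) w"
  using assms unfolding standardise_def sorted_wrt_map
  by (rule sorted_wrt_mono_rel[rotated]) (meson not_le rank_mono)

section \<open>Monotone subsequences\<close>

text \<open>Deleting from \<open>ys\<close> the values outside \<open>xs\<close> leaves a strictly increasing word with the same
  values as \<open>xs\<close>, and there is only one such word.\<close>

lemma strict_sorted_subset_subseq:
  fixes xs ys :: "'a::linorder list"
  assumes "sorted_wrt (<) xs" "sorted_wrt (<) ys" "set xs \<subseteq> set ys"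
  shows "subseq xs ys"
proof -
  have "filter (\<lambda>y. y \<in> set xs) ys = xs"
    using assms by (intro strict_sorted_equal) (auto simp: sorted_wrt_filter)
  then show ?thesis by (metis subseq_filter_left)
qed

lemma subseq_rev: "subseq xs ys \<Longrightarrow> subseq (rev xs) (rev ys)"
  by (induct rule: list_emb.induct) (auto intro: list_emb_append_mono subseq_rev_drop_many)

lemma subseq_if_positions_increase:
  assumes pos: "\<And>v. v \<in> set xs \<Longrightarrow> pos v < length w \<and> w ! pos v = v"
    and "sorted_wrt (\<lambda>u v. pos u < pos v) xs"
  shows "subseq xs w"
proof -
  have "subseq (map pos xs) [0..<length w]"
    using assms by (intro strict_sorted_subset_subseq) (auto simp: sorted_wrt_map)
  then have "subseq (map ((!) w) (map pos xs)) (map ((!) w) [0..<length w])"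
    by (rule subseq_map)
  moreover have "map ((!) w) (map pos xs) = xs" using pos by (simp add: map_idI)
  ultimately show ?thesis by (simp add: map_nth)
qed

text \<open>A form of the Erdos--Szekeres theorem for words with repeated entries: one occurrence of each
  value is singled out, and two values are compared by the order of their positions.\<close>

lemma monotone_values_in_word:
  fixes m n :: nat
  obtains r where "r \<ge> 1"
    "\<And>(V :: 'a::linorder set) w. \<lbrakk>V \<subseteq> set w; card V \<ge> r\<rbrakk> \<Longrightarrow>
      (\<exists>xs. set xs \<subseteq> V \<and> sorted_wrt (<) xs \<and>
        (length xs = m \<and> subseq xs w \<or> length xs = n \<and> subseq (rev xs) w))"
proof -
  obtain r where r: "r \<ge> 1" "\<And>(V :: 'a set) E. \<lbrakk>finite V; card V \<ge> r\<rbrakk> \<Longrightarrow>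
      (\<exists>X \<subseteq> V. card X = m \<and> clique X E \<or> card X = n \<and> indep X E)"
    using ramsey2[where 'a = 'a, of m n] by blast
  show thesis
  proof (rule that[OF r(1)])
    fix V :: "'a set" and w
    assume V: "V \<subseteq> set w" "card V \<ge> r"
    have finV: "finite V" using V(1) by (rule finite_subset) simp
    have "\<forall>v\<in>set w. \<exists>i. i < length w \<and> w ! i = v" by (simp add: in_set_conv_nth)
    then obtain pos where "\<forall>v\<in>set w. pos v < length w \<and> w ! pos v = v"
      unfolding bchoice_iff by blast
    then have pos: "\<And>v. v \<in> V \<Longrightarrow> pos v < length w \<and> w ! pos v = v" using V by blast
    \<comment> \<open>In this graph on the values, cliques occur in increasing order and, the positions being
      distinct, independent sets occur in decreasing order.\<close>
    define E where "E = {{u, v} | u v. u < v \<and> pos u < pos v}"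
    have E_iff: "{u, v} \<in> E \<longleftrightarrow> pos u < pos v" if "u < v" for u v
      using that by (auto simp: E_def doubleton_eq_iff)
    obtain X where X: "X \<subseteq> V" "card X = m \<and> clique X E \<or> card X = n \<and> indep X E"
      using r(2)[OF finV V(2)] by blast
    have finX: "finite X" using X(1) finV by (rule finite_subset)
    define xs where "xs = sorted_list_of_set X"
    have xs: "set xs = X" "sorted_wrt (<) xs" "length xs = card X"
      using finX by (auto simp: xs_def)
    have xs_pos: "\<And>v. v \<in> set xs \<Longrightarrow> pos v < length w \<and> w ! pos v = v"
      using pos X xs by blast
    have "subseq xs w" if "clique X E"
    proof (rule subseq_if_positions_increase[OF xs_pos])
      have "pos u < pos v" if "u \<in> set xs" "v \<in> set xs" "u < v" for u v
        using \<open>clique X E\<close> that xs(1) E_iff[OF that(3)] by (auto simp: clique_def)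
      then show "sorted_wrt (\<lambda>u v. pos u < pos v) xs"
        by (rule sorted_wrt_mono_rel[OF _ xs(2)])
    qed
    moreover have "subseq (rev xs) w" if "indep X E"
    proof (rule subseq_if_positions_increase)
      have "pos v < pos u" if uv: "u \<in> set xs" "v \<in> set xs" "u < v" for u v
      proof -
        have "\<not> pos u < pos v" using \<open>indep X E\<close> uv xs(1) E_iff[OF uv(3)] by (auto simp: indep_def)
        moreover have "pos u \<noteq> pos v" using xs_pos uv by (metis less_irrefl)
        ultimately show ?thesis by simp
      qed
      then show "sorted_wrt (\<lambda>u v. pos u < pos v) (rev xs)"
        unfolding sorted_wrt_rev by (rule sorted_wrt_mono_rel[OF _ xs(2)])
    qed (use xs_pos in auto)
    ultimately show "\<exists>xs. set xs \<subseteq> V \<and> sorted_wrt (<) xs \<and>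
        (length xs = m \<and> subseq xs w \<or> length xs = n \<and> subseq (rev xs) w)"
      using X xs by auto
  qed
qed

section \<open>Horizontal juxtapositions of monotone sequences\<close>

lemma horizontal_juxtaposition_append:
  assumes "horizontal_juxtaposition \<pi> \<sigma> \<tau>"
  shows "\<exists>\<alpha> \<beta>. \<pi> = \<alpha> @ \<beta> \<and> standardise \<alpha> = \<sigma> \<and> standardise \<beta> = \<tau>"
  using assms unfolding horizontal_juxtaposition_def by (metis append_take_drop_id)

lemma horizontal_juxtaposition_appendI:
  assumes "cayley (\<sigma> @ \<tau>)" "cayley \<sigma>" "cayley \<tau>"
  shows "horizontal_juxtaposition (\<sigma> @ \<tau>) \<sigma> \<tau>"
  using assms by (simp add: horizontal_juxtaposition_def standardise_cayley)

lemma H_II_E: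
  assumes "\<sigma> \<in> H_II"
  obtains \<alpha> \<beta> where "cayley \<sigma>" "\<sigma> = \<alpha> @ \<beta>" "sorted_wrt (<) \<alpha>" "sorted_wrt (<) \<beta>"
proof -
  obtain \<alpha>' \<beta>' where "horizontal_juxtaposition \<sigma> \<alpha>' \<beta>'"
    and sorted: "sorted_wrt (<) \<alpha>'" "sorted_wrt (<) \<beta>'"
    using assms unfolding H_II_def by blast
  then obtain \<alpha> \<beta> where "\<sigma> = \<alpha> @ \<beta>" "standardise \<alpha> = \<alpha>'" "standardise \<beta> = \<beta>'" "cayley \<sigma>"
    using horizontal_juxtaposition_append unfolding horizontal_juxtaposition_def by blast
  then show thesis
    using that sorted sorted_wrt_less_if_standardise by metis
qed

lemma H_ID_E:
  assumes "\<sigma> \<in> H_ID"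
  obtains \<alpha> \<beta> where "cayley \<sigma>" "\<sigma> = \<alpha> @ \<beta>" "sorted_wrt (<) \<alpha>" "sorted_wrt (>) \<beta>"
proof -
  obtain \<alpha>' \<beta>' where "horizontal_juxtaposition \<sigma> \<alpha>' \<beta>'"
    and sorted: "sorted_wrt (<) \<alpha>'" "sorted_wrt (>) \<beta>'"
    using assms unfolding H_ID_def by blast
  then obtain \<alpha> \<beta> where "\<sigma> = \<alpha> @ \<beta>" "standardise \<alpha> = \<alpha>'" "standardise \<beta> = \<beta>'" "cayley \<sigma>"
    using horizontal_juxtaposition_append unfolding horizontal_juxtaposition_def by blast
  then show thesis
    using that sorted sorted_wrt_less_if_standardise sorted_wrt_greater_if_standardise by metis
qed

lemma doubled_in_H_II: "[1..<Suc n] @ [1..<Suc n] \<in> H_II"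
proof -
  have "horizontal_juxtaposition ([1..<Suc n] @ [1..<Suc n]) [1..<Suc n] [1..<Suc n]"
    by (rule horizontal_juxtaposition_appendI; unfold cayley_iff; rule exI[of _ n]) auto
  then show ?thesis unfolding H_II_def by (blast intro: sorted_wrt_upt)
qed

lemma doubled_in_H_ID: "[1..<Suc n] @ rev [1..<Suc n] \<in> H_ID"
proof -
  have "horizontal_juxtaposition ([1..<Suc n] @ rev [1..<Suc n]) [1..<Suc n] (rev [1..<Suc n])"
    by (rule horizontal_juxtaposition_appendI; unfold cayley_iff; rule exI[of _ n]) auto
  moreover have "sorted_wrt (>) (rev [1..<Suc n])"
    unfolding sorted_wrt_rev by (rule sorted_wrt_upt)
  ultimately show ?thesis unfolding H_ID_def by (blast intro: sorted_wrt_upt)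
qed

text \<open>The increasing sequence \<open>xs\<close> serves as a copy of the whole range of values of \<open>\<alpha> @ \<beta>\<close>, and a
  strictly monotone word is determined by its set of values; so each half of \<open>\<alpha> @ \<beta>\<close> is obtained
  from the corresponding half of \<open>xs @ ys\<close> by deleting entries.\<close>

lemma contains_if_doubled:
  assumes "cayley (\<alpha> @ \<beta>)" "sorted_wrt (<) \<alpha>"
    and xs: "sorted_wrt (<) xs" "length xs = height (\<alpha> @ \<beta>)"
    and \<beta>: "sorted_wrt (<) \<beta> \<and> ys = xs \<or> sorted_wrt (>) \<beta> \<and> ys = rev xs"
    and "subseq (xs @ ys) \<pi>"
  shows "contains \<pi> (\<alpha> @ \<beta>)"
proof -
  define n where "n = height (\<alpha> @ \<beta>)"
  define f where "f i = xs ! (i - 1)" for i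
  have vals: "set (\<alpha> @ \<beta>) = {1..n}" using assms(1) by (simp add: cayley_def n_def)
  have f_xs: "map f [1..<Suc n] = xs"
    by (rule nth_equalityI) (use xs in \<open>auto simp: f_def n_def simp del: upt_Suc\<close>)
  have "strict_mono_on (set (\<alpha> @ \<beta>)) f"
    unfolding vals strict_mono_on_def
    using xs by (auto simp: f_def n_def intro!: sorted_wrt_nth_less[OF xs(1)])
  then have std: "standardise (map f (\<alpha> @ \<beta>)) = \<alpha> @ \<beta>"
    using standardise_map standardise_cayley[OF assms(1)] by metis
  have increasing: "subseq (map f \<gamma>) xs" if "sorted_wrt (<) \<gamma>" "set \<gamma> \<subseteq> {1..n}" for \<gamma>
  proof -
    have "subseq \<gamma> [1..<Suc n]"
      using that by (intro strict_sorted_subset_subseq) (auto simp del: upt_Suc)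
    then show ?thesis using subseq_map f_xs by metis
  qed
  have "subseq (map f \<alpha>) xs" using increasing assms(2) vals by auto
  moreover have "subseq (map f \<beta>) ys"
    using \<beta>
  proof (elim disjE conjE)
    assume "sorted_wrt (<) \<beta>" "ys = xs"
    then show ?thesis using increasing vals by auto
  next
    assume dec: "sorted_wrt (>) \<beta>" "ys = rev xs"
    have "sorted_wrt (<) (rev \<beta>)" using dec(1) by (simp add: sorted_wrt_rev)
    then have "subseq (map f (rev \<beta>)) xs" by (rule increasing) (use vals in auto)
    then show ?thesis using dec(2) subseq_rev[of "map f (rev \<beta>)" xs] by (simp add: rev_map)
  qed
  ultimately have "subseq (map f (\<alpha> @ \<beta>)) (xs @ ys)" by (simp add: list_emb_append_mono)
  then have "subseq (map f (\<alpha> @ \<beta>)) \<pi>" using assms(6) subseq_order.trans by blast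
  then show ?thesis using std unfolding contains_def by blast
qed

section \<open>Counting slots\<close>

text \<open>An occurrence of \<open>\<alpha> @ \<beta>\<close> splits into occurrences of \<open>\<alpha>\<close> and of \<open>\<beta>\<close>. These are ranked in the
  same word, where ranking is injective; so equal value sets of \<open>\<alpha>\<close> and \<open>\<beta>\<close> come from
  equal value sets in \<open>\<pi>\<close>.\<close>

lemma contains_append_imp_card_common:
  assumes "contains \<pi> (\<alpha> @ \<beta>)" "set \<alpha> = set \<beta>"
  obtains p s where "\<pi> = p @ s" "card (set \<alpha>) \<le> card (set p \<inter> set s)"
proof -
  obtain w where w: "subseq w \<pi>" "map (rank w) w = \<alpha> @ \<beta>"
    using assms(1) by (auto simp: contains_def standardise_def)
  then obtain w1 w2 where w12: "w = w1 @ w2" "map (rank w) w1 = \<alpha>" "map (rank w) w2 = \<beta>"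
    by (auto simp: map_eq_append_conv)
  obtain p s where ps: "\<pi> = p @ s" "subseq w1 p" "subseq w2 s"
    using w(1) w12(1) list_emb_appendD by blast
  have "rank w ` set w1 = rank w ` set w2" using w12 assms(2) by (metis set_map)
  then have "set w1 = set w2"
    using inj_on_image_eq_iff[OF inj_on_rank[of w]] w12(1) by simp
  then have "set w1 \<subseteq> set p \<inter> set s"
    using ps by (metis le_inf_iff set_nths_subset subseq_conv_nths)
  then have "card (set w1) \<le> card (set p \<inter> set s)" by (intro card_mono) auto
  moreover have "card (set \<alpha>) \<le> card (set w1)"
    using w12(2) by (metis card_image_le finite_set set_map)
  ultimately show thesis using that ps(1) by simp
qed

lemma slots_configuration_after:
  "slots (configuration_after (p @ s) (length p)) =
    (Repeating \<circ> rank p) ` (set p \<inter> set s) \<union>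
    (\<lambda>v. New (card {u \<in> set p. u < v})) ` (set s - set p)"
  by (auto simp: configuration_after_def Let_def)

lemma card_Repeating: "card ((Repeating \<circ> rank p) ` (set p \<inter> set s)) = card (set p \<inter> set s)"
proof (rule card_image, rule comp_inj_on)
  show "inj_on (rank p) (set p \<inter> set s)" using inj_on_rank by (rule inj_on_subset) auto
qed (auto intro: inj_onI)

lemma card_slots_ge: "card (set p \<inter> set s) \<le> card (slots (configuration_after (p @ s) (length p)))"
  unfolding slots_configuration_after card_Repeating[symmetric] by (rule card_mono) auto

lemma first_occ:
  assumes "v \<in> set w"
  shows "first_occ w v < length w" "w ! first_occ w v = v"
proof -
  have "\<exists>i. i < length w \<and> w ! i = v" using assms by (simp add: in_set_conv_nth)
  then have "first_occ w v < length w \<and> w ! first_occ w v = v"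
    unfolding first_occ_def by (rule LeastI_ex)
  then show "first_occ w v < length w" "w ! first_occ w v = v" by auto
qed

lemma first_occ_append_less:
  assumes "v \<in> set p" shows "first_occ (p @ s) v < length p"
proof -
  obtain i where "i < length p" "p ! i = v" using assms by (auto simp: in_set_conv_nth)
  then have "first_occ (p @ s) v \<le> i" unfolding first_occ_def
    by (intro Least_le) (auto simp: nth_append)
  then show ?thesis using \<open>i < length p\<close> by simp
qed

text \<open>A value smaller than \<open>u\<close> has its first occurrence before that of \<open>u\<close>, hence in the prefix.\<close>

lemma rgf_prefix_less_new_value:
  assumes "rgf (p @ s)" "u \<in> set p" "v \<in> set s" "v \<notin> set p"
  shows "u < v"
proof (rule ccontr)
  assume "\<not> u < v"
  then have "v < u" using assms by (metis linorder_neqE_nat)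
  moreover have "v \<ge> 1" using assms(1,3) by (auto simp: rgf_def cayley_def)
  ultimately have "first_occ (p @ s) v < first_occ (p @ s) u"
    using assms by (auto simp: rgf_def)
  also have "\<dots> < length p" using assms(2) by (rule first_occ_append_less)
  finally have "first_occ (p @ s) v < length p" .
  then have "v \<in> set p"
    using first_occ(2)[of v "p @ s"] assms(3) by (metis Un_iff nth_append nth_mem set_append)
  then show False using assms(4) by blast
qed

lemma rgf_card_slots_le:
  assumes "rgf (p @ s)"
  shows "card (slots (configuration_after (p @ s) (length p))) \<le> card (set p \<inter> set s) + 1"
proof -
  have "{u \<in> set p. u < v} = set p" if "v \<in> set s - set p" for v
    using rgf_prefix_less_new_value[OF assms] that by blast
  then have "(\<lambda>v. New (card {u \<in> set p. u < v})) ` (set s - set p) \<subseteq> {New (card (set p))}"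
    by auto
  then have "card ((\<lambda>v. New (card {u \<in> set p. u < v})) ` (set s - set p)) \<le> card {New (card (set p))}"
    by (intro card_mono) auto
  then show ?thesis
    unfolding slots_configuration_after card_Repeating[symmetric]
    by (intro order_trans[OF card_Un_le]) simp
qed

lemma rgf_increasing_values_in_prefix:
  assumes "rgf (p @ s)" "sorted_wrt (<) xs" "set xs \<subseteq> set p"
  shows "subseq xs p"
proof (rule subseq_if_positions_increase)
  fix v assume "v \<in> set xs"
  then have v: "v \<in> set p" using assms(3) by blast
  then show "first_occ (p @ s) v < length p \<and> p ! first_occ (p @ s) v = v"
    using first_occ_append_less[OF v, of s] first_occ(2)[of v "p @ s"] by (simp add: nth_append)
next
  have "first_occ (p @ s) u < first_occ (p @ s) v"
    if "u \<in> set xs" "v \<in> set xs" "u < v" for u v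
  proof -
    have "u \<in> set (p @ s)" "v \<in> set (p @ s)" using that assms(3) by auto
    moreover from this have "u \<ge> 1" using assms(1) by (auto simp: rgf_def cayley_def)
    ultimately show ?thesis using assms(1) that unfolding rgf_def by blast
  qed
  then show "sorted_wrt (\<lambda>u v. first_occ (p @ s) u < first_occ (p @ s) v) xs"
    by (rule sorted_wrt_mono_rel[OF _ assms(2)])
qed

text \<open>Cutting a word in two in all possible ways replaces the index \<open>t\<close> of the evolution.\<close>

lemma SB_H_iff:
  "\<pi> \<in> SB_H k \<longleftrightarrow> rgf \<pi> \<and>
    (\<forall>p s. \<pi> = p @ s \<longrightarrow> card (slots (configuration_after (p @ s) (length p))) \<le> k)"
proof -
  have "(\<forall>t\<le>length \<pi>. P t) \<longleftrightarrow> (\<forall>p s. \<pi> = p @ s \<longrightarrow> P (length p))" for P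
  proof
    assume cuts: "\<forall>p s. \<pi> = p @ s \<longrightarrow> P (length p)"
    show "\<forall>t\<le>length \<pi>. P t"
    proof (intro allI impI)
      fix t assume "t \<le> length \<pi>"
      then show "P t" using cuts[rule_format, of "take t \<pi>" "drop t \<pi>"] by simp
    qed
  qed auto
  from this[of "\<lambda>t. card (slots (configuration_after \<pi> t)) \<le> k"] show ?thesis
    by (auto simp: SB_H_def horizontal_evolution_def less_Suc_eq_le simp del: upt_Suc)
qed

lemma SB_H_avoids_doubled:
  assumes "\<pi> \<in> SB_H k" "set \<alpha> = set \<beta>" "card (set \<alpha>) > k"
  shows "avoids \<pi> (\<alpha> @ \<beta>)"
  unfolding avoids_def
proof
  assume "contains \<pi> (\<alpha> @ \<beta>)"
  then obtain p s where ps: "\<pi> = p @ s" "card (set \<alpha>) \<le> card (set p \<inter> set s)"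
    using assms(2) by (rule contains_append_imp_card_common)
  have "card (slots (configuration_after (p @ s) (length p))) \<le> k"
    using assms(1) ps(1) by (simp add: SB_H_iff)
  then show False using card_slots_ge[of p s] ps(2) assms(3) by linarith
qed

lemma rgf_avoiding_imp_SB_H:
  assumes "\<sigma> \<in> H_II" "\<tau> \<in> H_ID"
  obtains k where "k > 0"
    "\<And>\<pi>. \<lbrakk>rgf \<pi>; avoids \<pi> \<sigma>; avoids \<pi> \<tau>\<rbrakk> \<Longrightarrow> \<pi> \<in> SB_H k"
proof -
  obtain \<alpha> \<beta> where \<sigma>: "cayley \<sigma>" "\<sigma> = \<alpha> @ \<beta>" "sorted_wrt (<) \<alpha>" "sorted_wrt (<) \<beta>"
    using assms(1) by (rule H_II_E)
  obtain \<gamma> \<delta> where \<tau>: "cayley \<tau>" "\<tau> = \<gamma> @ \<delta>" "sorted_wrt (<) \<gamma>" "sorted_wrt (>) \<delta>"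
    using assms(2) by (rule H_ID_E)
  obtain r where r: "r \<ge> 1" "\<And>(V :: nat set) w. \<lbrakk>V \<subseteq> set w; card V \<ge> r\<rbrakk> \<Longrightarrow>
      (\<exists>xs. set xs \<subseteq> V \<and> sorted_wrt (<) xs \<and>
        (length xs = height \<sigma> \<and> subseq xs w \<or> length xs = height \<tau> \<and> subseq (rev xs) w))"
    using monotone_values_in_word[where 'a = nat, of "height \<sigma>" "height \<tau>"] by blast
  show thesis
  proof (rule that)
    \<comment> \<open>At most \<open>r - 1\<close> repeating slots and one new slot.\<close>
    show "r > 0" using r(1) by simp
    fix \<pi> assume \<pi>: "rgf \<pi>" "avoids \<pi> \<sigma>" "avoids \<pi> \<tau>"
    have "card (slots (configuration_after (p @ s) (length p))) \<le> r" if ps: "\<pi> = p @ s" for p s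
    proof -
      have "card (set p \<inter> set s) < r"
      proof (rule ccontr)
        assume "\<not> card (set p \<inter> set s) < r"
        then obtain xs where xs: "set xs \<subseteq> set p \<inter> set s" "sorted_wrt (<) xs"
          "length xs = height \<sigma> \<and> subseq xs s \<or> length xs = height \<tau> \<and> subseq (rev xs) s"
          using r(2)[of "set p \<inter> set s" s] by auto
        have "subseq xs p"
          using \<pi>(1) xs ps by (intro rgf_increasing_values_in_prefix[of p s]) auto
        then have doubled: "subseq (xs @ ys) \<pi>" if "subseq ys s" for ys
          using that ps by (simp add: list_emb_append_mono)
        from xs(3) have "contains \<pi> \<sigma> \<or> contains \<pi> \<tau>"
        proof (elim disjE conjE)
          assume "length xs = height \<sigma>" "subseq xs s"
          then have "contains \<pi> \<sigma>"
            unfolding \<sigma>(2) using \<sigma> xs(2) by (intro contains_if_doubled[OF _ _ _ _ _ doubled]) auto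
          then show ?thesis by simp
        next
          assume "length xs = height \<tau>" "subseq (rev xs) s"
          then have "contains \<pi> \<tau>"
            unfolding \<tau>(2) using \<tau> xs(2) by (intro contains_if_doubled[OF _ _ _ _ _ doubled]) auto
          then show ?thesis by simp
        qed
        then show False using \<pi> by (simp add: avoids_def)
      qed
      then show ?thesis using rgf_card_slots_le[of p s] \<pi>(1) ps by simp
    qed
    then show "\<pi> \<in> SB_H r" using \<pi>(1) by (simp add: SB_H_iff)
  qed
qed

section \<open>Bounded slots and avoided juxtapositions\<close>

theorem theorem2p4:
  fixes R :: "nat list set"
  assumes "rgf_class R"
  shows "(\<exists>k>0. R \<subseteq> SB_H k) \<longleftrightarrow>
    (\<exists>\<sigma>\<in>H_II. \<exists>\<tau>\<in>H_ID. set_avoids R \<sigma> \<and> set_avoids R \<tau>)"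
proof
  assume "\<exists>k>0. R \<subseteq> SB_H k"
  then obtain k where k: "R \<subseteq> SB_H k" by blast
  \<comment> \<open>\<open>k + 1\<close> values, one more than the number of slots allowed.\<close>
  let ?u = "[1..<Suc (Suc k)]"
  have "set_avoids R (?u @ ?u)" "set_avoids R (?u @ rev ?u)"
    unfolding set_avoids_def using k
    by (auto intro!: SB_H_avoids_doubled[of _ k] simp del: upt_Suc)
  then show "\<exists>\<sigma>\<in>H_II. \<exists>\<tau>\<in>H_ID. set_avoids R \<sigma> \<and> set_avoids R \<tau>"
    using doubled_in_H_II doubled_in_H_ID by blast
next
  assume "\<exists>\<sigma>\<in>H_II. \<exists>\<tau>\<in>H_ID. set_avoids R \<sigma> \<and> set_avoids R \<tau>"
  then obtain \<sigma> \<tau> where st: "\<sigma> \<in> H_II" "\<tau> \<in> H_ID" "set_avoids R \<sigma>" "set_avoids R \<tau>" by blast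
  obtain k where k: "k > 0" "\<And>\<pi>. \<lbrakk>rgf \<pi>; avoids \<pi> \<sigma>; avoids \<pi> \<tau>\<rbrakk> \<Longrightarrow> \<pi> \<in> SB_H k"
    using rgf_avoiding_imp_SB_H[OF st(1,2)] by blast
  have "\<forall>\<pi>\<in>R. rgf \<pi>" using assms by (auto simp: rgf_class_def rgfs_avoiding_def)
  then have "R \<subseteq> SB_H k" using st(3,4) k(2) by (auto simp: set_avoids_def)
  then show "\<exists>k>0. R \<subseteq> SB_H k" using k(1) by blast
qed

end
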